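(* Let $\alpha,\beta$ be permutations with $|\alpha|>1$ and $|\beta|\ge1$, let $0\le k\le|\alpha|$, and let $\pi=\alpha\,\triangle_k\,\beta$ be the wedge permutation. Then $$\mu[1,\pi]=-\sum_{\lambda\in\mathsf{R}_\pi}\mu[1,\lambda],$$ where $\mathsf{R}_\pi$ is the set of proper reductions of $\pi$.
   Context: Permutations are ordered by classical pattern containment ($\sigma\le\pi$ if $\pi$ has a subsequence order-isomorphic to $\sigma$), and $\mu[\sigma,\pi]$ is the Möbius function of this poset: $\mu[\sigma,\sigma]=1$, $\mu[\sigma,\pi]=0$ if $\sigma\not\le\pi$, and $\mu[\sigma,\pi]=-\sum_{\sigma\le\lambda<\pi}\mu[\sigma,\lambda]$ if $\sigma<\pi$. Here $1$ is the permutation of length one. For permutations $\alpha$ (length $a$) and $\beta$ (length $b$) and $0\le k\le a$, the wedge permutation $\alpha\,\triangle_k\,\beta$ is the permutation of length $a+b$ $$\alpha_1,\dots,\alpha_k,\;\beta_1+a,\dots,\beta_b+a,\;\alpha_{k+1},\dots,\alpha_a .$$ In $\pi=\alpha\,\triangle_k\,\beta$, colour blue the points in positions $k+1,\dots,k+b$ (the copy of $\beta$) and red the remaining points. An embedding of $\lambda$ into $\pi$ is a set of $|\lambda|$ points of $\pi$ order-isomorphic to $\lambda$. A non-empty permutation $\lambda<\pi$ is a proper reduction of $\pi$ if every embedding of $\lambda$ into $\pi$ uses all the blue points; $\mathsf{R}_\pi$ is the set of proper reductions. *)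

theory Defs
  imports Main "HOL-Library.Sublist"
begin

text \<open>A permutation of length n is given in one-line notation, as a list with entries 1, ..., n.
  The empty list is the empty permutation and [1] is the permutation of length one.\<close>

definition is_perm :: "nat list \<Rightarrow> bool" where
  "is_perm p \<longleftrightarrow> distinct p \<and> set p = {1..length p}"

definition order_iso :: "nat list \<Rightarrow> nat list \<Rightarrow> bool" where
  "order_iso xs ys \<longleftrightarrow> length xs = length ys \<and>
     (\<forall>i<length xs. \<forall>j<length xs. xs ! i < xs ! j \<longleftrightarrow> ys ! i < ys ! j)"

definition pattern_le :: "nat list \<Rightarrow> nat list \<Rightarrow> bool" where
  "pattern_le s p \<longleftrightarrow> is_perm s \<and> is_perm p \<and> (\<exists>ys. subseq ys p \<and> order_iso ys s)"

definition pattern_less :: "nat list \<Rightarrow> nat list \<Rightarrow> bool" where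
  "pattern_less s p \<longleftrightarrow> pattern_le s p \<and> s \<noteq> p"

lemma perm_nth_rank:
  assumes "is_perm p" "i < length p"
  shows "p ! i = Suc (card {j. j < length p \<and> p ! j < p ! i})"
proof -
  let ?J = "{j. j < length p \<and> p ! j < p ! i}"
  from assms have d: "distinct p" and s: "set p = {1..length p}"
    by (auto simp: is_perm_def)
  have le: "1 \<le> p ! i" "p ! i \<le> length p"
    using nth_mem[OF assms(2)] unfolding s by auto
  have "inj_on (nth p) ?J"
    using d by (auto simp: inj_on_def nth_eq_iff_index_eq)
  then have "card ?J = card (nth p ` ?J)"
    by (simp add: card_image)
  also have "nth p ` ?J = {v \<in> set p. v < p ! i}"
    by (auto simp: in_set_conv_nth)
  also have "\<dots> = {1..<p ! i}"
    using le unfolding s by auto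
  finally show ?thesis
    using le by simp
qed

lemma order_iso_perm_eq:
  assumes "is_perm p" "is_perm q" "order_iso p q"
  shows "p = q"
proof (rule nth_equalityI)
  show l: "length p = length q"
    using assms(3) by (simp add: order_iso_def)
  fix i assume i: "i < length p"
  have "{j. j < length p \<and> p ! j < p ! i} = {j. j < length q \<and> q ! j < q ! i}"
    using assms(3) i l by (auto simp: order_iso_def)
  then show "p ! i = q ! i"
    using perm_nth_rank[OF assms(1) i] perm_nth_rank[OF assms(2), of i] i l by simp
qed

lemma pattern_le_length: "pattern_le s p \<Longrightarrow> length s \<le> length p"
  by (auto simp: pattern_le_def order_iso_def dest: list_emb_length)

lemma pattern_less_length:
  assumes "pattern_less s p"
  shows "length s < length p"
proof (rule ccontr)
  assume "\<not> length s < length p"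
  with assms have l: "length s = length p"
    using pattern_le_length[of s p] by (auto simp: pattern_less_def)
  from assms obtain ys where ys: "subseq ys p" "order_iso ys s" "is_perm s" "is_perm p" "s \<noteq> p"
    by (auto simp: pattern_less_def pattern_le_def)
  then have "ys = p"
    using l by (auto simp: order_iso_def intro: subseq_same_length)
  with ys show False
    using order_iso_perm_eq by blast
qed

lemma finite_pattern_below: "finite {l. pattern_le l p}"
proof (rule finite_subset)
  show "{l. pattern_le l p} \<subseteq> {l. set l \<subseteq> {1..length p} \<and> length l \<le> length p}"
  proof safe
    fix l assume l: "pattern_le l p"
    from pattern_le_length[OF this] show "length l \<le> length p" .
    fix x assume "x \<in> set l"
    with l have "x \<in> {1..length l}"
      by (simp add: pattern_le_def is_perm_def)
    with \<open>length l \<le> length p\<close> show "x \<in> {1..length p}"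
      by simp
  qed
qed (rule finite_lists_length_le, simp)

function perm_mu :: "nat list \<Rightarrow> nat list \<Rightarrow> int" where
  "perm_mu s p =
     (if s = p then 1
      else if pattern_le s p
        then - (\<Sum>l | pattern_le s l \<and> pattern_less l p. perm_mu s l)
      else 0)"
  by pat_completeness auto
termination
  by (relation "measure (\<lambda>(s, p). length p)") (auto dest: pattern_less_length)

declare perm_mu.simps [simp del]

definition wedge :: "nat list \<Rightarrow> nat \<Rightarrow> nat list \<Rightarrow> nat list" where
  "wedge a k b = take k a @ map (\<lambda>x. x + length a) b @ drop k a"

lemma is_perm_wedge:
  assumes "is_perm a" "is_perm b"
  shows "is_perm (wedge a k b)"
proof -
  have sa: "set (take k a) \<union> set (drop k a) = {1..length a}"
    using assms(1) by (simp add: is_perm_def flip: set_append)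
  have sb: "set (map (\<lambda>x. x + length a) b) = {length a + 1..length a + length b}"
    using assms(2) by (simp add: is_perm_def add.commute)
  have l: "length (wedge a k b) = length a + length b"
    by (simp add: wedge_def)
  have s: "set (wedge a k b) = {1..length a + length b}"
  proof -
    have "set (wedge a k b) = {1..length a} \<union> {length a + 1..length a + length b}"
      unfolding wedge_def set_append sb sa[symmetric] by blast
    also have "\<dots> = {1..length a + length b}"
      by auto
    finally show ?thesis .
  qed
  have "card (set (wedge a k b)) = length (wedge a k b)"
    unfolding s l by simp
  then have "distinct (wedge a k b)"
    by (rule card_distinct)
  then show ?thesis
    unfolding is_perm_def s l by simp
qed

text \<open>The points of p are identified with their (0-based) positions.\<close>

definition is_embedding :: "nat set \<Rightarrow> nat list \<Rightarrow> nat list \<Rightarrow> bool" where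
  "is_embedding S l p \<longleftrightarrow> S \<subseteq> {..<length p} \<and> order_iso (nths p S) l"

lemma is_embedding_card: "is_embedding S l p \<Longrightarrow> card S = length l"
proof -
  assume e: "is_embedding S l p"
  then have "{i. i < length p \<and> i \<in> S} = S"
    by (auto simp: is_embedding_def)
  with e show "card S = length l"
    by (simp add: is_embedding_def order_iso_def length_nths)
qed

lemma pattern_le_iff_embedding:
  "pattern_le l p \<longleftrightarrow> is_perm l \<and> is_perm p \<and> (\<exists>S. is_embedding S l p)"
proof -
  have "(\<exists>ys. subseq ys p \<and> order_iso ys l) \<longleftrightarrow> (\<exists>S. is_embedding S l p)"
  proof
    assume "\<exists>ys. subseq ys p \<and> order_iso ys l"
    then obtain N where N: "order_iso (nths p N) l"
      by (auto simp: subseq_conv_nths)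
    have "nths p (N \<inter> {..<length p}) = nths p N"
      unfolding nths_def
      by (intro arg_cong[where f = "map fst"] filter_cong) (auto simp: set_zip)
    with N show "\<exists>S. is_embedding S l p"
      by (intro exI[of _ "N \<inter> {..<length p}"]) (auto simp: is_embedding_def)
  next
    assume "\<exists>S. is_embedding S l p"
    then show "\<exists>ys. subseq ys p \<and> order_iso ys l"
      by (auto simp: is_embedding_def subseq_conv_nths)
  qed
  then show ?thesis
    by (auto simp: pattern_le_def)
qed

definition blue_points :: "nat \<Rightarrow> nat list \<Rightarrow> nat set" where
  "blue_points k b = {k..<k + length b}"

text \<open>The colouring, and hence the set of proper reductions, depends on the presentation of the
  permutation as a wedge and not only on the permutation itself.\<close>

definition proper_reductions :: "nat list \<Rightarrow> nat \<Rightarrow> nat list \<Rightarrow> nat list set" where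
  "proper_reductions a k b =
     {l. l \<noteq> [] \<and> pattern_less l (wedge a k b) \<and>
         (\<forall>S. is_embedding S l (wedge a k b) \<longrightarrow> blue_points k b \<subseteq> S)}"

lemma finite_proper_reductions: "finite (proper_reductions a k b)"
  by (rule finite_subset[OF _ finite_pattern_below[of "wedge a k b"]])
     (auto simp: proper_reductions_def pattern_less_def)

end

theory Submission
  imports Defs
begin

text \<open>
  Fix \<open>\<alpha>\<close> and \<open>k\<close>, and write \<open>\<pi>\<^sub>\<delta>\<close> for the wedge permutation of \<open>\<alpha>\<close> and \<open>\<delta>\<close>, for every
  permutation \<open>\<delta>\<close>, the empty one included. The idea is that each non-empty \<open>\<lambda> \<le> \<pi>\<^sub>\<beta>\<close> has a unique
  core, a minimal \<open>\<delta> \<le> \<beta>\<close> with \<open>\<lambda> \<le> \<pi>\<^sub>\<delta>\<close>. One exists by finiteness. It is unique because the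
  blue points are larger than the red ones and occupy consecutive positions: an embedding of
  \<open>\<lambda>\<close> that uses all of \<open>\<delta>\<close> shows \<open>\<delta>\<close> as the pattern of the \<open>|\<delta>|\<close> largest entries of \<open>\<lambda>\<close>,
  and the largest entries of one \<open>\<lambda>\<close> are nested (\<open>top_block_pattern\<close>). Two cores of \<open>\<lambda>\<close> are therefore comparable, hence equal (\<open>core_classes_disjoint\<close>).

  So the interval from 1 to \<open>\<pi>\<^sub>\<beta>\<close> is the disjoint union, over \<open>\<delta> \<le> \<beta>\<close>, of the classes of
  permutations with core \<open>\<delta>\<close>. As \<open>\<pi>\<^sub>\<beta>\<close> is longer than 1, the values \<open>\<mu>[1, \<lambda>]\<close> sum to 0 over
  the interval, for every \<open>\<beta>\<close>; induction on \<open>|\<beta>|\<close> then makes the sum over every single class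
  vanish (\<open>sum_core_class\<close>). Finally, \<open>\<lambda>\<close> has core \<open>\<beta>\<close> exactly if no embedding into \<open>\<pi>\<^sub>\<beta>\<close>
  misses a blue point, which means that \<open>\<lambda>\<close> is \<open>\<pi>\<^sub>\<beta>\<close> itself or a proper reduction; separating
  the term of \<open>\<pi>\<^sub>\<beta>\<close> in the vanishing sum gives the theorem.
\<close>

section \<open>Order isomorphism and standardization\<close>

lemma order_iso_refl: "order_iso xs xs"
  by (simp add: order_iso_def)

lemma order_iso_sym: "order_iso xs ys \<Longrightarrow> order_iso ys xs"
  by (auto simp: order_iso_def)

lemma order_iso_trans: "order_iso xs ys \<Longrightarrow> order_iso ys zs \<Longrightarrow> order_iso xs zs"
  by (auto simp: order_iso_def)

lemma order_iso_map:
  assumes "\<And>x y. x \<in> set xs \<Longrightarrow> y \<in> set xs \<Longrightarrow> f x < f y \<longleftrightarrow> x < y"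
  shows "order_iso xs (map f xs)"
  using assms by (auto simp: order_iso_def)

text \<open>The relabelling of values is a function because equal entries of the first list are
  incomparable, so the corresponding entries of the second list are equal too.\<close>

lemma order_iso_obtain_map:
  assumes "order_iso xs ys"
  obtains f where "ys = map f xs"
    "\<And>x y. x \<in> set xs \<Longrightarrow> y \<in> set xs \<Longrightarrow> f x < f y \<longleftrightarrow> x < y"
proof -
  define pos where "pos x = (SOME i. i < length xs \<and> xs ! i = x)" for x
  have pos: "pos x < length xs" "xs ! pos x = x" if "x \<in> set xs" for x
    using someI_ex[of "\<lambda>i. i < length xs \<and> xs ! i = x"] that
    unfolding pos_def in_set_conv_nth by blast+
  have len: "length xs = length ys"
    and iso: "\<And>i j. i < length xs \<Longrightarrow> j < length xs \<Longrightarrow> ys ! i < ys ! j \<longleftrightarrow> xs ! i < xs ! j"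
    using assms by (auto simp: order_iso_def)
  show thesis
  proof (rule that[of "\<lambda>x. ys ! pos x"])
    show "ys = map (\<lambda>x. ys ! pos x) xs"
    proof (rule nth_equalityI)
      fix i assume "i < length ys"
      then have i: "i < length xs"
        using len by simp
      then have "pos (xs ! i) < length xs" "xs ! pos (xs ! i) = xs ! i"
        by (auto intro: pos)
      then have "ys ! i = ys ! pos (xs ! i)"
        using iso[OF i, of "pos (xs ! i)"] iso[of "pos (xs ! i)", OF _ i]
        by (metis less_irrefl linorder_neq_iff)
      then show "ys ! i = map (\<lambda>x. ys ! pos x) xs ! i"
        using i by simp
    qed (simp add: len)
    show "ys ! pos x < ys ! pos y \<longleftrightarrow> x < y" if "x \<in> set xs" "y \<in> set xs" for x y
      using iso[of "pos x" "pos y"] pos that by simp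
  qed
qed

lemma subseq_set: "subseq xs ys \<Longrightarrow> set xs \<subseteq> set ys"
  by (auto dest: list_emb_set)

lemma subseq_order_iso:
  assumes "subseq xs ys" "order_iso ys zs"
  obtains ws where "subseq ws zs" "order_iso xs ws"
proof -
  obtain f where f: "zs = map f ys"
    "\<And>x y. x \<in> set ys \<Longrightarrow> y \<in> set ys \<Longrightarrow> f x < f y \<longleftrightarrow> x < y"
    by (rule order_iso_obtain_map[OF assms(2)]) blast
  show thesis
  proof (rule that)
    show "subseq (map f xs) zs"
      unfolding f(1) by (rule subseq_map) (rule assms)
    show "order_iso xs (map f xs)"
      using subseq_set[OF assms(1)] by (intro order_iso_map f(2)) auto
  qed
qed

lemma pattern_le_trans:
  assumes "pattern_le p q" "pattern_le q r"
  shows "pattern_le p r"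
proof -
  obtain ys where ys: "subseq ys q" "order_iso ys p"
    using assms(1) by (auto simp: pattern_le_def)
  obtain zs where zs: "subseq zs r" "order_iso zs q"
    using assms(2) by (auto simp: pattern_le_def)
  obtain ws where "subseq ws zs" "order_iso ys ws"
    using subseq_order_iso[OF ys(1) order_iso_sym[OF zs(2)]] .
  then have "subseq ws r" "order_iso ws p"
    using ys zs by (meson order_iso_sym order_iso_trans subseq_order.order_trans)+
  then show ?thesis
    using assms by (auto simp: pattern_le_def)
qed

lemma pattern_le_refl: "is_perm p \<Longrightarrow> pattern_le p p"
  using order_iso_refl by (auto simp: pattern_le_def)

text \<open>Replacing each entry by its rank turns a list of distinct numbers into a permutation.\<close>

lemma standardization_exists:
  assumes "distinct ys"
  obtains p where "is_perm p" "order_iso ys p"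
proof -
  define rank where "rank x = card {y \<in> set ys. y \<le> x}" for x
  have less: "rank x < rank y" if "x < y" "y \<in> set ys" for x y
  proof -
    have "y \<in> {z \<in> set ys. z \<le> y}" "y \<notin> {z \<in> set ys. z \<le> x}"
      using that by simp_all
    moreover have "{z \<in> set ys. z \<le> x} \<subseteq> {z \<in> set ys. z \<le> y}"
      using that by auto
    ultimately show ?thesis
      unfolding rank_def by (intro psubset_card_mono psubsetI) (simp, assumption, blast)
  qed
  have rank_iff: "rank x < rank y \<longleftrightarrow> x < y" if "x \<in> set ys" "y \<in> set ys" for x y
    using less[of x y] less[of y x] that by (cases x y rule: linorder_cases) auto
  have "inj_on rank (set ys)"
    using rank_iff by (metis inj_onI less_irrefl linorder_neq_iff)
  then have dist: "distinct (map rank ys)"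
    using assms by (simp add: distinct_map)
  have "rank x \<in> {1..length ys}" if "x \<in> set ys" for x
  proof -
    have "rank x \<le> card (set ys)"
      unfolding rank_def by (rule card_mono) auto
    moreover have "rank x \<noteq> 0"
      using that by (auto simp: rank_def)
    ultimately show ?thesis
      using assms by (simp add: distinct_card)
  qed
  then have "set (map rank ys) \<subseteq> {1..length ys}"
    by auto
  moreover have "card (set (map rank ys)) = length ys"
    using distinct_card[OF dist] by simp
  ultimately have "set (map rank ys) = {1..length ys}"
    by (intro card_subset_eq) auto
  then have "is_perm (map rank ys)"
    using dist by (simp add: is_perm_def)
  moreover have "order_iso ys (map rank ys)"
    by (rule order_iso_map) (rule rank_iff)
  ultimately show thesis
    by (rule that)
qed

section \<open>Subsequences of a wedge\<close>

lemma is_perm_bounds: "is_perm p \<Longrightarrow> x \<in> set p \<Longrightarrow> 1 \<le> x \<and> x \<le> length p"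
  by (auto simp: is_perm_def)

text \<open>The red points keep their values when the blue ones are relabelled, since the shift by
  \<open>|\<alpha>|\<close> puts every blue value above every red one.\<close>

lemma order_iso_replace_blue:
  assumes "order_iso v v'" "\<And>x. x \<in> set u \<union> set w \<Longrightarrow> x \<le> n"
    "\<And>x. x \<in> set v \<Longrightarrow> 0 < x" "\<And>x. x \<in> set v' \<Longrightarrow> 0 < (x::nat)"
  shows "order_iso (u @ map (\<lambda>x. x + n) v @ w) (u @ map (\<lambda>x. x + n) v' @ w)"
proof -
  obtain g where g: "v' = map g v"
    "\<And>x y. x \<in> set v \<Longrightarrow> y \<in> set v \<Longrightarrow> g x < g y \<longleftrightarrow> x < y"
    by (rule order_iso_obtain_map[OF assms(1)]) blast
  define f where "f x = (if n < x then g (x - n) + n else x)" for x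
  let ?xs = "u @ map (\<lambda>x. x + n) v @ w"
  have red: "f x = x" if "x \<in> set u \<union> set w" for x
    using assms(2)[OF that] by (simp add: f_def)
  have blue: "f (x + n) = g x + n" if "x \<in> set v" for x
    using assms(3)[OF that] by (simp add: f_def)
  have pos: "0 < g x" if "x \<in> set v" for x
    using assms(4) that g(1) by auto
  have "map f ?xs = u @ map (\<lambda>x. x + n) v' @ w"
    using red blue by (auto simp: g(1) intro!: map_idI)
  moreover have "order_iso ?xs (map f ?xs)"
  proof (rule order_iso_map)
    fix x y assume xy: "x \<in> set ?xs" "y \<in> set ?xs"
    have cases: "z \<le> n \<and> f z = z \<or> (\<exists>t\<in>set v. z = t + n \<and> f z = g t + n)"
      if "z \<in> set ?xs" for z
      using that red blue assms(2) by auto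
    show "f x < f y \<longleftrightarrow> x < y"
      using cases[OF xy(1)] cases[OF xy(2)]
    proof (elim disjE conjE bexE)
      fix s t assume "s \<in> set v" "t \<in> set v"
        "x = s + n" "f x = g s + n" "y = t + n" "f y = g t + n"
      then show ?thesis
        using g(2) by simp
    next
      fix t assume "t \<in> set v" "x \<le> n" "f x = x" "y = t + n" "f y = g t + n"
      then show ?thesis
        using pos[of t] assms(3)[of t] by simp
    next
      fix s assume "s \<in> set v" "y \<le> n" "f y = y" "x = s + n" "f x = g s + n"
      then show ?thesis
        using pos[of s] assms(3)[of s] by simp
    qed simp
  qed
  ultimately show ?thesis
    by simp
qed

text \<open>An embedding is described here by the entries of \<open>b\<close> that it uses, not by its positions, because
  only this part of it changes when \<open>b\<close> is replaced by another permutation.\<close>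

definition occurs_with_blue ::
    "nat list \<Rightarrow> nat \<Rightarrow> nat list \<Rightarrow> nat list \<Rightarrow> nat list \<Rightarrow> bool" where
  "occurs_with_blue a k b v l \<longleftrightarrow> subseq v b \<and>
     (\<exists>u w. subseq u (take k a) \<and> subseq w (drop k a) \<and>
        order_iso (u @ map (\<lambda>x. x + length a) v @ w) l)"

lemma subseq_map_obtain:
  assumes "subseq ys (map f xs)"
  obtains zs where "subseq zs xs" "ys = map f zs"
  using assms by (auto simp: subseq_conv_nths nths_map)

lemma pattern_le_wedge_iff:
  assumes "is_perm a" "is_perm b"
  shows "pattern_le l (wedge a k b) \<longleftrightarrow> is_perm l \<and> (\<exists>v. occurs_with_blue a k b v l)"
proof
  assume le: "pattern_le l (wedge a k b)"
  then obtain ys where ys: "subseq ys (wedge a k b)" "order_iso ys l"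
    by (auto simp: pattern_le_def)
  then obtain u v' w where u: "subseq u (take k a)" and
    v': "subseq v' (map (\<lambda>x. x + length a) b)" and w: "subseq w (drop k a)" and
    "ys = u @ v' @ w"
    unfolding wedge_def by (auto elim!: subseq_appendE)
  moreover obtain v where "subseq v b" "v' = map (\<lambda>x. x + length a) v"
    using subseq_map_obtain[OF v'] .
  ultimately have "occurs_with_blue a k b v l"
    using ys(2) by (auto simp: occurs_with_blue_def)
  then show "is_perm l \<and> (\<exists>v. occurs_with_blue a k b v l)"
    using le by (auto simp: pattern_le_def)
next
  assume "is_perm l \<and> (\<exists>v. occurs_with_blue a k b v l)"
  then obtain u v w where "is_perm l" "subseq u (take k a)" "subseq v b" "subseq w (drop k a)"
    and iso: "order_iso (u @ map (\<lambda>x. x + length a) v @ w) l"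
    by (auto simp: occurs_with_blue_def)
  moreover from this have "subseq (u @ map (\<lambda>x. x + length a) v @ w) (wedge a k b)"
    unfolding wedge_def by (intro list_emb_append_mono subseq_map)
  ultimately show "pattern_le l (wedge a k b)"
    using is_perm_wedge[OF assms] by (auto simp: pattern_le_def)
qed

lemma occurs_with_blue_order_iso:
  assumes "is_perm a" "is_perm b" "is_perm b'"
    and "occurs_with_blue a k b v l" "subseq v' b'" "order_iso v v'"
  shows "occurs_with_blue a k b' v' l"
proof -
  obtain u w where uw: "subseq u (take k a)" "subseq w (drop k a)"
    and iso: "order_iso (u @ map (\<lambda>x. x + length a) v @ w) l"
    using assms(4) by (auto simp: occurs_with_blue_def)
  have v: "subseq v b"
    using assms(4) by (simp add: occurs_with_blue_def)
  have red: "x \<le> length a" if "x \<in> set u \<union> set w" for x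
    using that subseq_set[OF uw(1)] subseq_set[OF uw(2)] is_perm_bounds[OF assms(1), of x]
    by (auto dest: in_set_takeD in_set_dropD)
  have "0 < x" if "x \<in> set v \<union> set v'" for x
    using that subseq_set[OF v] subseq_set[OF assms(5)]
      is_perm_bounds[OF assms(2), of x] is_perm_bounds[OF assms(3), of x] by auto
  then have "order_iso (u @ map (\<lambda>x. x + length a) v @ w) (u @ map (\<lambda>x. x + length a) v' @ w)"
    by (intro order_iso_replace_blue[OF assms(6)] red) auto
  then have "order_iso (u @ map (\<lambda>x. x + length a) v' @ w) l"
    using iso order_iso_sym order_iso_trans by blast
  then show ?thesis
    using uw assms(5) by (auto simp: occurs_with_blue_def)
qed

text \<open>Missing a blue point means living in the wedge of a strictly smaller permutation: the
  standardization of the blue points that are used.\<close>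

lemma occurs_missing_blue_iff:
  assumes "is_perm a" "is_perm b" "is_perm l"
  shows "(\<exists>v. v \<noteq> b \<and> occurs_with_blue a k b v l) \<longleftrightarrow>
    (\<exists>d. pattern_less d b \<and> pattern_le l (wedge a k d))"
proof
  assume "\<exists>v. v \<noteq> b \<and> occurs_with_blue a k b v l"
  then obtain v where v: "v \<noteq> b" "subseq v b" "occurs_with_blue a k b v l"
    by (auto simp: occurs_with_blue_def)
  have "distinct v"
    using v(2) assms(2) by (auto simp: is_perm_def subseq_conv_nths)
  then obtain d where d: "is_perm d" "order_iso v d"
    by (rule standardization_exists)
  have "length d \<noteq> length b"
    using d(2) v(1) subseq_same_length[OF v(2)] by (auto simp: order_iso_def)
  then have "pattern_less d b"
    using d v(2) assms(2) by (auto simp: pattern_less_def pattern_le_def)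
  moreover have "occurs_with_blue a k d d l"
    by (rule occurs_with_blue_order_iso[OF assms(1,2) d(1) v(3) _ d(2)]) simp
  ultimately show "\<exists>d. pattern_less d b \<and> pattern_le l (wedge a k d)"
    using pattern_le_wedge_iff[OF assms(1) d(1)] assms(3) by blast
next
  assume "\<exists>d. pattern_less d b \<and> pattern_le l (wedge a k d)"
  then obtain d where d: "pattern_less d b" "pattern_le l (wedge a k d)"
    by blast
  then obtain ys where ys: "subseq ys b" "order_iso ys d" and pd: "is_perm d"
    by (auto simp: pattern_less_def pattern_le_def)
  obtain v where v: "occurs_with_blue a k d v l" "subseq v d"
    using d(2) pattern_le_wedge_iff[OF assms(1) pd] by (auto simp: occurs_with_blue_def)
  obtain v' where v': "subseq v' ys" "order_iso v v'"
    using subseq_order_iso[OF v(2) order_iso_sym[OF ys(2)]] .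
  have "subseq v' b"
    using v'(1) ys(1) by (rule subseq_order.order_trans)
  then have "occurs_with_blue a k b v' l"
    using occurs_with_blue_order_iso[OF assms(1) pd assms(2) v(1)] v'(2) by blast
  moreover have "length v' < length b"
    using pattern_less_length[OF d(1)] list_emb_length[OF v(2)] v'(2)
    by (simp add: order_iso_def)
  then have "v' \<noteq> b"
    by auto
  ultimately show "\<exists>v. v \<noteq> b \<and> occurs_with_blue a k b v l"
    by blast
qed

section \<open>Embeddings and blue points\<close>

lemma nths_cong_below:
  assumes "\<And>i. i < length xs \<Longrightarrow> i \<in> A \<longleftrightarrow> i \<in> B"
  shows "nths xs A = nths xs B"
  unfolding nths_def
  by (intro arg_cong[where f = "map fst"] filter_cong) (use assms in \<open>auto simp: set_zip\<close>)

lemma nths_eq_self_iff: "nths xs A = xs \<longleftrightarrow> {..<length xs} \<subseteq> A"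
proof
  assume "nths xs A = xs"
  then have "card {i. i < length xs \<and> i \<in> A} = card {..<length xs}"
    by (metis card_lessThan length_nths)
  then have "{i. i < length xs \<and> i \<in> A} = {..<length xs}"
    by (intro card_subset_eq) auto
  then show "{..<length xs} \<subseteq> A"
    by auto
next
  assume "{..<length xs} \<subseteq> A"
  then show "nths xs A = xs"
    by (intro nths_all) auto
qed

lemma nths_wedge:
  assumes "k \<le> length a"
  shows "nths (wedge a k b) S = nths (take k a) S @
    map (\<lambda>x. x + length a) (nths b {j. j + k \<in> S}) @ nths (drop k a) {j. j + length b + k \<in> S}"
  using assms by (simp add: wedge_def nths_append nths_map min_absorb2)

text \<open>A subsequence of the wedge splits into its red prefix, its blue part and its red suffix; the
  set of positions contains all blue points exactly if the blue part is the whole of \<open>b\<close>.\<close>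

lemma embedding_missing_blue_iff:
  assumes "k \<le> length a"
  shows "(\<exists>S. is_embedding S l (wedge a k b) \<and> \<not> blue_points k b \<subseteq> S) \<longleftrightarrow>
    (\<exists>v. v \<noteq> b \<and> occurs_with_blue a k b v l)"
proof -
  have blue: "blue_points k b \<subseteq> S \<longleftrightarrow> nths b {j. j + k \<in> S} = b" for S
  proof -
    have "blue_points k b = (\<lambda>j. j + k) ` {..<length b}"
      by (simp add: blue_points_def lessThan_atLeast0 add.commute)
    then show ?thesis
      by (auto simp: nths_eq_self_iff)
  qed
  show ?thesis
  proof
    assume "\<exists>S. is_embedding S l (wedge a k b) \<and> \<not> blue_points k b \<subseteq> S"
    then obtain S where S: "order_iso (nths (wedge a k b) S) l" "\<not> blue_points k b \<subseteq> S"
      by (auto simp: is_embedding_def)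
    then have "occurs_with_blue a k b (nths b {j. j + k \<in> S}) l"
      unfolding nths_wedge[OF assms] occurs_with_blue_def by (auto simp: subseq_conv_nths)
    then show "\<exists>v. v \<noteq> b \<and> occurs_with_blue a k b v l"
      using S(2) blue by blast
  next
    assume "\<exists>v. v \<noteq> b \<and> occurs_with_blue a k b v l"
    then obtain u v w where uvw: "v \<noteq> b" "subseq u (take k a)" "subseq v b" "subseq w (drop k a)"
      "order_iso (u @ map (\<lambda>x. x + length a) v @ w) l"
      by (auto simp: occurs_with_blue_def)
    obtain M where u: "u = nths (take k a) M"
      using uvw(2) by (auto simp: subseq_conv_nths)
    obtain N where v: "v = nths b N"
      using uvw(3) by (auto simp: subseq_conv_nths)
    obtain P where w: "w = nths (drop k a) P"
      using uvw(4) by (auto simp: subseq_conv_nths)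
    define S where "S = {i. i < length a + length b \<and>
      (if i < k then i \<in> M else if i < k + length b then i - k \<in> N else i - (k + length b) \<in> P)}"
    have v_S: "nths b {j. j + k \<in> S} = v"
      unfolding v by (rule nths_cong_below) (use assms in \<open>auto simp: S_def\<close>)
    have "nths (take k a) S = u"
      unfolding u by (rule nths_cong_below) (use assms in \<open>auto simp: S_def\<close>)
    moreover have "nths (drop k a) {j. j + length b + k \<in> S} = w"
      unfolding w by (rule nths_cong_below) (use assms in \<open>auto simp: S_def add.commute add.left_commute\<close>)
    ultimately have "order_iso (nths (wedge a k b) S) l"
      unfolding nths_wedge[OF assms] v_S using uvw(5) by simp
    moreover have "S \<subseteq> {..<length (wedge a k b)}"
      by (auto simp: S_def wedge_def)
    moreover have "\<not> blue_points k b \<subseteq> S"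
      using blue v_S uvw(1) by simp
    ultimately show "\<exists>S. is_embedding S l (wedge a k b) \<and> \<not> blue_points k b \<subseteq> S"
      by (auto simp: is_embedding_def)
  qed
qed

section \<open>Cores\<close>

text \<open>The blue positions carry the largest values, so the positions of the shorter blue block are
  among those of the longer one: otherwise there would be a position in the first block only and
  one in the second block only, ordered oppositely by the two lists. Contiguity of the blocks then
  makes the pattern of the shorter block a factor of the longer one.\<close>

lemma top_block_pattern:
  assumes iso: "order_iso (u\<^sub>1 @ map (\<lambda>x. x + n) d\<^sub>1 @ w\<^sub>1) (u\<^sub>2 @ map (\<lambda>x. x + n) d\<^sub>2 @ w\<^sub>2)"
    and len: "length d\<^sub>1 \<le> length d\<^sub>2"
    and red1: "\<And>x. x \<in> set u\<^sub>1 \<union> set w\<^sub>1 \<Longrightarrow> x \<le> n"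
    and red2: "\<And>x. x \<in> set u\<^sub>2 \<union> set w\<^sub>2 \<Longrightarrow> x \<le> n"
    and perm: "is_perm d\<^sub>1" "is_perm d\<^sub>2"
  shows "pattern_le d\<^sub>1 d\<^sub>2"
proof (cases "d\<^sub>1 = []")
  case True
  then show ?thesis
    using perm order_iso_refl[of "[]"] by (auto simp: pattern_le_def)
next
  case False
  define xs where "xs = u\<^sub>1 @ map (\<lambda>x. x + n) d\<^sub>1 @ w\<^sub>1"
  define ys where "ys = u\<^sub>2 @ map (\<lambda>x. x + n) d\<^sub>2 @ w\<^sub>2"
  define I where "I = {length u\<^sub>1..<length u\<^sub>1 + length d\<^sub>1}"
  define J where "J = {length u\<^sub>2..<length u\<^sub>2 + length d\<^sub>2}"
  have lxy: "length xs = length ys"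
    and xy: "\<And>i j. i < length xs \<Longrightarrow> j < length xs \<Longrightarrow> xs ! i < xs ! j \<longleftrightarrow> ys ! i < ys ! j"
    using iso by (auto simp: order_iso_def xs_def ys_def)
  have blue: "n < (u @ map (\<lambda>x. x + n) d @ w) ! i"
    if "i \<in> {length u..<length u + length d}" "is_perm d" for u d w :: "nat list" and i
    using that is_perm_bounds[OF that(2), of "d ! (i - length u)"]
    by (auto simp: nth_append)
  have red: "(u @ map (\<lambda>x. x + n) d @ w) ! i \<le> n"
    if "i \<notin> {length u..<length u + length d}" "i < length (u @ map (\<lambda>x. x + n) d @ w)"
      "\<And>x. x \<in> set u \<union> set w \<Longrightarrow> x \<le> n" for u d w :: "nat list" and i
    using that(1,2) by (auto simp: nth_append intro!: that(3))
  have "I \<subseteq> J"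
  proof (rule ccontr)
    assume "\<not> I \<subseteq> J"
    then obtain i where i: "i \<in> I" "i \<notin> J"
      by blast
    (* J is at least as large as I, so J inside I would force I = J. *)
    have "\<not> J \<subseteq> I"
      using i len card_seteq[of I J] by (auto simp: I_def J_def)
    then obtain j where j: "j \<in> J" "j \<notin> I"
      by blast
    have bounds: "i < length xs" "j < length xs"
      using i(1) j(1) lxy by (auto simp: I_def J_def xs_def ys_def)
    have "xs ! j \<le> n" "n < xs ! i"
      unfolding xs_def
      by (rule red blue; use i j bounds perm red1 in \<open>simp add: I_def xs_def\<close>)+
    moreover have "ys ! i \<le> n" "n < ys ! j"
      unfolding ys_def
      by (rule red blue; use i j bounds perm red2 lxy in \<open>simp add: J_def ys_def\<close>)+
    ultimately show False
      using xy[OF bounds] xy[OF bounds(2,1)] by linarith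
  qed
  then have le: "length u\<^sub>2 \<le> length u\<^sub>1" "length u\<^sub>1 + length d\<^sub>1 \<le> length u\<^sub>2 + length d\<^sub>2"
    using False unfolding I_def J_def by (simp_all add: ivl_subset)
  define m where "m = length u\<^sub>1 - length u\<^sub>2"
  define zs where "zs = take (length d\<^sub>1) (drop m d\<^sub>2)"
  have lz: "length zs = length d\<^sub>1"
    using le by (simp add: zs_def m_def)
  have d1: "d\<^sub>1 ! i + n = xs ! (length u\<^sub>1 + i)" if "i < length d\<^sub>1" for i
    using that by (simp add: xs_def nth_append)
  have d2: "zs ! i + n = ys ! (length u\<^sub>1 + i)" if "i < length d\<^sub>1" for i
  proof -
    have "length u\<^sub>1 + i = length u\<^sub>2 + (m + i)" "m + i < length d\<^sub>2"
      using that le by (auto simp: m_def)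
    then show ?thesis
      using that by (simp add: zs_def ys_def nth_append)
  qed
  have "order_iso zs d\<^sub>1"
    unfolding order_iso_def
  proof (intro conjI allI impI)
    fix i j assume ij: "i < length zs" "j < length zs"
    then have "length u\<^sub>1 + i < length xs" "length u\<^sub>1 + j < length xs"
      by (simp_all add: xs_def lz)
    from xy[OF this] show "zs ! i < zs ! j \<longleftrightarrow> d\<^sub>1 ! i < d\<^sub>1 ! j"
      using d1[of i] d1[of j] d2[of i] d2[of j] ij lz by linarith
  qed (rule lz)
  moreover have "subseq zs d\<^sub>2"
    unfolding zs_def
    by (rule subseq_order.order_trans[OF prefix_imp_subseq[OF take_is_prefix]
          suffix_imp_subseq[OF suffix_drop]])
  ultimately show ?thesis
    using perm by (auto simp: pattern_le_def)
qed

text \<open>The condition is only that \<open>d\<close> is minimal, not that it is the least such permutation: in this form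
  it says that no embedding misses a blue point, and uniqueness of \<open>d\<close> follows.\<close>

definition core_class :: "nat list \<Rightarrow> nat \<Rightarrow> nat list \<Rightarrow> nat list set" where
  "core_class a k d = {l. l \<noteq> [] \<and> pattern_le l (wedge a k d) \<and>
     (\<forall>d'. pattern_less d' d \<longrightarrow> \<not> pattern_le l (wedge a k d'))}"

text \<open>By minimality every occurrence of \<open>l\<close> uses all blue points, so the core can be read off from
  any of them.\<close>

lemma core_class_occurs:
  assumes "is_perm a" "is_perm d" "l \<in> core_class a k d"
  shows "occurs_with_blue a k d d l"
proof -
  have l: "pattern_le l (wedge a k d)" "is_perm l"
    using assms(3) by (auto simp: core_class_def pattern_le_def)
  then obtain v where "occurs_with_blue a k d v l"
    using pattern_le_wedge_iff[OF assms(1,2)] by blast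
  moreover have "v = d"
    using calculation occurs_missing_blue_iff[OF assms(1,2) l(2), of k] assms(3)
    by (auto simp: core_class_def)
  ultimately show ?thesis
    by simp
qed

text \<open>The shorter of two cores is a pattern of the longer one, and it cannot be a proper one because
  the longer core is minimal too.\<close>

lemma core_classes_disjoint:
  assumes "is_perm a" "is_perm d\<^sub>1" "is_perm d\<^sub>2"
    and "l \<in> core_class a k d\<^sub>1" "l \<in> core_class a k d\<^sub>2"
  shows "d\<^sub>1 = d\<^sub>2"
  using assms(2-)
proof (induction "length d\<^sub>1" "length d\<^sub>2" arbitrary: d\<^sub>1 d\<^sub>2 rule: linorder_wlog)
  case le
  have red: "x \<le> length a"
    if "subseq u (take k a)" "subseq w (drop k a)" "x \<in> set u \<union> set w" for u w x
    using that subseq_set[OF that(1)] subseq_set[OF that(2)] is_perm_bounds[OF assms(1), of x]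
    by (auto dest: in_set_takeD in_set_dropD)
  obtain u\<^sub>1 w\<^sub>1 where 1: "subseq u\<^sub>1 (take k a)" "subseq w\<^sub>1 (drop k a)"
    "order_iso (u\<^sub>1 @ map (\<lambda>x. x + length a) d\<^sub>1 @ w\<^sub>1) l"
    using core_class_occurs[OF assms(1) le(2,4)] by (auto simp: occurs_with_blue_def)
  obtain u\<^sub>2 w\<^sub>2 where 2: "subseq u\<^sub>2 (take k a)" "subseq w\<^sub>2 (drop k a)"
    "order_iso (u\<^sub>2 @ map (\<lambda>x. x + length a) d\<^sub>2 @ w\<^sub>2) l"
    using core_class_occurs[OF assms(1) le(3,5)] by (auto simp: occurs_with_blue_def)
  have "pattern_le d\<^sub>1 d\<^sub>2"
    using order_iso_trans[OF 1(3) order_iso_sym[OF 2(3)]] le(1) red[OF 1(1,2)] red[OF 2(1,2)] le(2,3)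
    by (rule top_block_pattern)
  moreover have "\<not> pattern_less d\<^sub>1 d\<^sub>2"
    using le(4,5) by (auto simp: core_class_def)
  ultimately show ?case
    by (simp add: pattern_less_def)
qed auto

text \<open>The wedge of \<open>d\<close> is contained in itself, so for \<open>d\<close> strictly below \<open>b\<close> it occurs in the
  wedge of \<open>b\<close> with some blue point missing.\<close>

lemma pattern_le_wedge_mono:
  assumes "is_perm a" "pattern_le d b"
  shows "pattern_le (wedge a k d) (wedge a k b)"
proof (cases "d = b")
  case True
  moreover have "is_perm b"
    using assms(2) by (simp add: pattern_le_def)
  ultimately show ?thesis
    using pattern_le_refl[OF is_perm_wedge[OF assms(1)]] by simp
next
  case False
  have perm: "is_perm d" "is_perm b" "is_perm (wedge a k d)"
    using assms by (auto simp: pattern_le_def is_perm_wedge)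
  have "pattern_less d b"
    using False assms(2) by (simp add: pattern_less_def)
  then show ?thesis
    using occurs_missing_blue_iff[OF assms(1) perm(2,3), of k] pattern_le_refl[OF perm(3)]
      pattern_le_wedge_iff[OF assms(1) perm(2), of _ k] perm(3) by blast
qed

lemma exists_core:
  assumes "is_perm b" "l \<noteq> []" "pattern_le l (wedge a k b)"
  obtains d where "pattern_le d b" "l \<in> core_class a k d"
proof -
  define P where "P d \<longleftrightarrow> pattern_le d b \<and> pattern_le l (wedge a k d)" for d
  have "P b"
    using assms pattern_le_refl by (auto simp: P_def)
  then obtain d where d: "P d" "\<And>d'. P d' \<Longrightarrow> length d \<le> length d'"
    using ex_has_least_nat[of P b length] by blast
  have "\<not> pattern_le l (wedge a k d')" if less: "pattern_less d' d" for d'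
  proof
    assume "pattern_le l (wedge a k d')"
    moreover have "pattern_le d' b"
      using less d(1) pattern_le_trans by (auto simp: P_def pattern_less_def)
    ultimately have "length d \<le> length d'"
      using d(2) by (simp add: P_def)
    then show False
      using pattern_less_length[OF less] by simp
  qed
  then have "l \<in> core_class a k d"
    using d(1) assms(2) by (auto simp: core_class_def P_def)
  then show thesis
    using d(1) that by (auto simp: P_def)
qed

text \<open>The wedge of \<open>b\<close> itself is too long to be contained in the wedge of a smaller permutation. For
  every other permutation, minimality of \<open>b\<close> says that no embedding misses a blue point.\<close>

lemma core_class_eq:
  assumes "is_perm a" "is_perm b" "k \<le> length a" "length a > 0"
  shows "core_class a k b = insert (wedge a k b) (proper_reductions a k b)"
proof -
  have missing: "(\<forall>d. pattern_less d b \<longrightarrow> \<not> pattern_le l (wedge a k d)) \<longleftrightarrow>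
      (\<forall>S. is_embedding S l (wedge a k b) \<longrightarrow> blue_points k b \<subseteq> S)" if "is_perm l" for l
    using occurs_missing_blue_iff[OF assms(1,2) that, of k] embedding_missing_blue_iff[OF assms(3), of l b]
    by blast
  have len: "length (wedge a k d) = length a + length d" for d
    by (simp add: wedge_def)
  have "\<not> pattern_le (wedge a k b) (wedge a k d)" if "pattern_less d b" for d
    using pattern_less_length[OF that] pattern_le_length[of "wedge a k b" "wedge a k d"] len by auto
  moreover have "wedge a k b \<noteq> []"
    using len[of b] assms(4) by auto
  ultimately have "wedge a k b \<in> core_class a k b"
    using pattern_le_refl[OF is_perm_wedge[OF assms(1,2)]] by (auto simp: core_class_def)
  moreover have "l \<in> core_class a k b \<longleftrightarrow> l \<in> proper_reductions a k b"
    if "l \<noteq> wedge a k b" for l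
    unfolding core_class_def proper_reductions_def pattern_less_def[of l] mem_Collect_eq
    using missing[of l] that by (auto simp: pattern_le_def)
  ultimately show ?thesis
    by (auto simp: proper_reductions_def pattern_less_def)
qed

section \<open>Summing the Moebius function over cores\<close>

lemma singleton_pattern_le_iff: "pattern_le [1] p \<longleftrightarrow> is_perm p \<and> p \<noteq> []"
proof
  assume "is_perm p \<and> p \<noteq> []"
  then have "subseq [hd p] p" "order_iso [hd p] [1]" "is_perm [1::nat]"
    by (cases p; simp add: order_iso_def is_perm_def)+
  then show "pattern_le [1] p"
    using \<open>is_perm p \<and> p \<noteq> []\<close> by (auto simp: pattern_le_def)
qed (auto simp: pattern_le_def order_iso_def)

lemma sum_perm_mu_interval:
  assumes "pattern_less s p"
  shows "(\<Sum>l | pattern_le s l \<and> pattern_le l p. perm_mu s l) = 0"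
proof -
  have p: "pattern_le s p" "s \<noteq> p" "is_perm p"
    using assms by (auto simp: pattern_less_def pattern_le_def)
  then have "{l. pattern_le s l \<and> pattern_le l p} =
      insert p {l. pattern_le s l \<and> pattern_less l p}"
    using pattern_le_refl by (auto simp: pattern_less_def)
  moreover have "finite {l. pattern_le s l \<and> pattern_less l p}"
    by (rule finite_subset[OF _ finite_pattern_below[of p]]) (auto simp: pattern_less_def)
  ultimately show ?thesis
    using p perm_mu.simps[of s p] by (simp add: pattern_less_def)
qed

text \<open>The interval is partitioned by cores, and by induction the classes of all smaller cores
  contribute 0, so only the class of \<open>b\<close> is left. The length of \<open>a\<close> makes the interval non-trivial
  even when \<open>b\<close> is empty, where the induction starts.\<close>

lemma sum_core_class:
  assumes "is_perm a" "length a > 1" "is_perm b"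
  shows "(\<Sum>l\<in>core_class a k b. perm_mu [1] l) = 0"
  using assms(3)
proof (induction b rule: measure_induct_rule[of length])
  case (less b)
  let ?cores = "{d. pattern_le d b}"
  let ?g = "\<lambda>d. \<Sum>l\<in>core_class a k d. perm_mu [1] l"
  have perm: "is_perm d" if "d \<in> ?cores" for d
    using that by (simp add: pattern_le_def)
  have fin: "finite (core_class a k d)" for d
    by (rule finite_subset[OF _ finite_pattern_below[of "wedge a k d"]])
      (auto simp: core_class_def)
  have "{l. pattern_le [1] l \<and> pattern_le l (wedge a k b)} = (\<Union>d\<in>?cores. core_class a k d)"
  proof (intro equalityI subsetI)
    fix l assume "l \<in> {l. pattern_le [1] l \<and> pattern_le l (wedge a k b)}"
    then have "l \<noteq> []" "pattern_le l (wedge a k b)"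
      unfolding singleton_pattern_le_iff by auto
    then obtain d where "pattern_le d b" "l \<in> core_class a k d"
      using exists_core[OF less.prems] by blast
    then show "l \<in> (\<Union>d\<in>?cores. core_class a k d)"
      by blast
  next
    fix l assume "l \<in> (\<Union>d\<in>?cores. core_class a k d)"
    then obtain d where d: "pattern_le d b" "l \<noteq> []" "pattern_le l (wedge a k d)"
      by (auto simp: core_class_def)
    then have "pattern_le l (wedge a k b)"
      using pattern_le_trans pattern_le_wedge_mono[OF assms(1)] by blast
    then show "l \<in> {l. pattern_le [1] l \<and> pattern_le l (wedge a k b)}"
      using d(2,3) unfolding singleton_pattern_le_iff by (simp add: pattern_le_def)
  qed
  moreover have "pattern_less [1] (wedge a k b)"
  proof -
    have "length (wedge a k b) > 1"
      using assms(2) by (simp add: wedge_def)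
    then have "wedge a k b \<noteq> []" "wedge a k b \<noteq> [1]"
      by auto
    then show ?thesis
      using is_perm_wedge[OF assms(1) less.prems, of k]
      unfolding pattern_less_def singleton_pattern_le_iff by metis
  qed
  ultimately have "0 = (\<Sum>l\<in>(\<Union>d\<in>?cores. core_class a k d). perm_mu [1] l)"
    using sum_perm_mu_interval[of "[1]" "wedge a k b"] by simp
  also have "\<dots> = (\<Sum>d\<in>?cores. ?g d)"
    using core_classes_disjoint[OF assms(1)] perm fin finite_pattern_below[of b]
    by (intro sum.UNION_disjoint) blast+
  also have "\<dots> = ?g b + (\<Sum>d\<in>?cores - {b}. ?g d)"
    using finite_pattern_below pattern_le_refl[OF less.prems] by (intro sum.remove) auto
  also have "(\<Sum>d\<in>?cores - {b}. ?g d) = 0"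
    using less.IH perm pattern_less_length by (intro sum.neutral) (auto simp: pattern_less_def)
  finally show ?case
    by simp
qed

theorem lemma72:
  fixes \<alpha> \<beta> :: "nat list" and k :: nat
  assumes "is_perm \<alpha>" and "is_perm \<beta>"
    and "length \<alpha> > 1" and "length \<beta> \<ge> 1"
    and "k \<le> length \<alpha>"
  shows "perm_mu [1] (wedge \<alpha> k \<beta>) = - (\<Sum>l\<in>proper_reductions \<alpha> k \<beta>. perm_mu [1] l)"
proof -
  have "wedge \<alpha> k \<beta> \<notin> proper_reductions \<alpha> k \<beta>"
    by (simp add: proper_reductions_def pattern_less_def)
  then have "(\<Sum>l\<in>core_class \<alpha> k \<beta>. perm_mu [1] l) =
      perm_mu [1] (wedge \<alpha> k \<beta>) + (\<Sum>l\<in>proper_reductions \<alpha> k \<beta>. perm_mu [1] l)"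
    using assms(3) finite_proper_reductions by (subst core_class_eq[OF assms(1,2,5)]) auto
  then show ?thesis
    using sum_core_class[OF assms(1,3,2)] by simp
qed

end
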